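(* There is a distribution-free sample-based $\epsilon$-tester for $k$-juntas on domain $\{0,1\}^n$ with one-sided error and sample complexity $$O\left(\frac{k\,2^{k/2}\log(n/k)}{\epsilon}\right).$$
   Context: Here $n,k$ are positive integers and $\epsilon>0$. A $k$-junta on $\{0,1\}^n$ is a function $f:\{0,1\}^n\to\{0,1\}$ that depends on only $k$ of its $n$ variables. For a probability distribution $\mathcal{D}$ on $\mathcal{X}$ and a class $\mathcal{H}$ of functions $\mathcal{X}\to\{0,1\}$, $\mathrm{dist}_{\mathcal{D}}(f,\mathcal{H})=\inf_{h\in\mathcal{H}}\Pr_{x\sim\mathcal{D}}[f(x)\ne h(x)]$. A distribution-free sample-based $\epsilon$-tester for $\mathcal{H}$ with sample complexity $m$ is a randomized algorithm which, for every unknown probability distribution $\mathcal{D}$ on $\mathcal{X}$ and every unknown $f:\mathcal{X}\to\{0,1\}$, receives $m$ labelled examples $(x,f(x))$ with $x$ drawn independently from $\mathcal{D}$, accepts with probability at least $2/3$ if $f\in\mathcal{H}$, and rejects with probability at least $2/3$ if $\mathrm{dist}_{\mathcal{D}}(f,\mathcal{H})\ge\epsilon$. It has one-sided error if it accepts with probability $1$ whenever $f\in\mathcal{H}$.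
   Formalization: The factor log(n/k) is read as max(1, log₂(n/k)); read literally the bound is negative for k > n and fails at k = n−1 (parity under the uniform distribution needs more than O(2^{n/2}) samples). *)

theory Defs
  imports "HOL-Probability.Probability"
begin

text \<open>
  The domain is an explicit set \<open>X\<close>. Functions on \<open>X\<close> are represented by total functions
  whose values outside \<open>X\<close> are irrelevant, since all distributions considered are supported
  on \<open>X\<close>. As \<open>X\<close> is finite here, probability distributions on \<open>X\<close> are exactly the pmfs with
  support in \<open>X\<close>.
\<close>

definition cube :: "nat \<Rightarrow> bool list set" where
  "cube n = {x. length x = n}"

definition juntas :: "nat \<Rightarrow> nat \<Rightarrow> (bool list \<Rightarrow> bool) set" where
  "juntas n k = {f. \<exists>J \<subseteq> {..<n}. card J \<le> k \<and>
     (\<forall>x \<in> cube n. \<forall>y \<in> cube n. (\<forall>i \<in> J. x ! i = y ! i) \<longrightarrow> f x = f y)}"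

definition dist_class :: "'a pmf \<Rightarrow> ('a \<Rightarrow> bool) \<Rightarrow> ('a \<Rightarrow> bool) set \<Rightarrow> real" where
  "dist_class D f H = (INF h\<in>H. measure_pmf.prob D {x. f x \<noteq> h x})"

text \<open>
  A randomized algorithm maps each labelled sample to a distribution over its verdicts
  (\<open>True\<close> means accept). The pmf below is its output distribution, over both the i.i.d. sample
  of size \<open>m\<close> and the internal randomness.
\<close>

definition run_tester ::
  "(('a \<times> bool) list \<Rightarrow> bool pmf) \<Rightarrow> nat \<Rightarrow> 'a pmf \<Rightarrow> ('a \<Rightarrow> bool) \<Rightarrow> bool pmf" where
  "run_tester T m D f =
     bind_pmf (replicate_pmf m D) (\<lambda>xs. T (map (\<lambda>x. (x, f x)) xs))"

definition df_sample_tester ::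
  "'a set \<Rightarrow> ('a \<Rightarrow> bool) set \<Rightarrow> real \<Rightarrow> nat \<Rightarrow> (('a \<times> bool) list \<Rightarrow> bool pmf) \<Rightarrow> bool" where
  "df_sample_tester X H \<epsilon> m T \<longleftrightarrow>
     (\<forall>D f. set_pmf D \<subseteq> X \<longrightarrow>
        (f \<in> H \<longrightarrow> pmf (run_tester T m D f) True \<ge> 2/3) \<and>
        (dist_class D f H \<ge> \<epsilon> \<longrightarrow> pmf (run_tester T m D f) False \<ge> 2/3))"

definition one_sided_error ::
  "'a set \<Rightarrow> ('a \<Rightarrow> bool) set \<Rightarrow> nat \<Rightarrow> (('a \<times> bool) list \<Rightarrow> bool pmf) \<Rightarrow> bool" where
  "one_sided_error X H m T \<longleftrightarrow>
     (\<forall>D f. set_pmf D \<subseteq> X \<longrightarrow> f \<in> H \<longrightarrow> pmf (run_tester T m D f) True = 1)"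

text \<open>
  The factor \<open>log (n/k)\<close> of the sample complexity. Under an O it is read with the usual
  convention that a logarithmic factor is at least 1; for \<open>n \<ge> 2 * k\<close> it is exactly
  \<open>log 2 (n/k)\<close>. Without the convention the bound would be negative for \<open>k > n\<close>, and too
  small for \<open>k = n - 1\<close>: to reject parity under the uniform distribution, a one-sided tester
  has to see an edge of the cube in each of the \<open>n\<close> directions, which takes more than
  \<open>O(2 powr (n/2))\<close> samples, while \<open>k * log 2 (n/k)\<close> stays bounded.
\<close>

definition log_factor :: "nat \<Rightarrow> nat \<Rightarrow> real" where
  "log_factor n k = max 1 (log 2 (real n / real k))"

end

theory Submission
  imports Defs
begin

text \<open>
  The tester accepts iff some \<open>k\<close>-junta is consistent with the sample, so only rejection needs proof.
  Fix a set \<open>J\<close> of \<open>k\<close> coordinates, which partitions the cube into \<open>2 ^ k\<close> cells, and let \<open>p z\<close> and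
  \<open>q z\<close> be the masses of the 0- and 1-labelled points of the cell \<open>z\<close>. If \<open>f\<close> is far from juntas, then
  the numbers \<open>a z = min (p z) (q z)\<close> sum to at least \<open>\<epsilon>\<close>. Among \<open>2 * m\<close> samples, no cell receives a
  0-labelled point in the first half and a 1-labelled point in the second half with probability at
  most the product over \<open>z\<close> of \<open>1 - (1 - exp (- m * p z)) * (1 - exp (- m * q z))\<close>, by negative
  dependence of the cells. By Cauchy-Schwarz this is at most \<open>exp (- 1 / 4)\<close> as soon as
  \<open>m \<ge> 2 powr (k / 2) / \<epsilon>\<close>. Repeating for \<open>O (k * log (n / k))\<close> independent batches beats the union
  bound over the \<open>n choose k \<le> (e * n / k) ^ k\<close> choices of \<open>J\<close>.
\<close>

section \<open>Independent samples and elementary estimates\<close>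

lemma prob_bind_pmf:
  "measure_pmf.prob (bind_pmf M N) A = (\<integral>x. measure_pmf.prob (N x) A \<partial>measure_pmf M)"
proof -
  have "ennreal (measure_pmf.prob (bind_pmf M N) A) = (\<integral>\<^sup>+x. ennreal (measure_pmf.prob (N x) A) \<partial>measure_pmf M)"
    by (simp flip: measure_pmf.emeasure_eq_measure)
  also have "\<dots> = ennreal (\<integral>x. measure_pmf.prob (N x) A \<partial>measure_pmf M)"
    by (intro nn_integral_eq_integral measure_pmf.integrable_const_bound[where B=1]) auto
  finally show ?thesis
    by (subst (asm) ennreal_inj) (auto intro: integral_nonneg)
qed

lemma integrable_measure_pmf_unit_bound:
  fixes f :: "'a \<Rightarrow> real"
  assumes "\<And>x. 0 \<le> f x" "\<And>x. f x \<le> 1"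
  shows "integrable (measure_pmf M) f"
  using assms by (intro measure_pmf.integrable_const_bound[where B=1]) auto

lemma prob_replicate_pmf_add:
  "measure_pmf.prob (replicate_pmf (a + b) D) {zs. P zs} =
     (\<integral>xs. measure_pmf.prob (replicate_pmf b D) {ys. P (xs @ ys)} \<partial>measure_pmf (replicate_pmf a D))"
  unfolding replicate_pmf_distrib map_pmf_def[symmetric] prob_bind_pmf[of "replicate_pmf a D"]
  by (simp add: vimage_def)

lemma prob_replicate_pmf_all:
  "measure_pmf.prob (replicate_pmf m D) {xs. set xs \<subseteq> A} = measure_pmf.prob D A ^ m"
proof (induction m)
  case 0
  then show ?case by simp
next
  case (Suc m)
  have "measure_pmf.prob (replicate_pmf (Suc m) D) {xs. set xs \<subseteq> A} =
      (\<integral>x. measure_pmf.prob (replicate_pmf m D) {xs. x \<in> A \<and> set xs \<subseteq> A} \<partial>measure_pmf D)"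
    by (simp add: prob_bind_pmf[of D] map_pmf_def[symmetric] vimage_def)
  also have "\<dots> = (\<integral>x. measure_pmf.prob D A ^ m * indicator A x \<partial>measure_pmf D)"
    by (intro Bochner_Integration.integral_cong) (auto simp: Suc indicator_def)
  finally show ?case by simp
qed

lemma one_minus_power_le_exp:
  assumes "0 \<le> (s::real)" "s \<le> 1"
  shows "(1 - s) ^ m \<le> exp (- real m * s)"
proof -
  have "(1 - s) ^ m \<le> exp (- s) ^ m"
    using assms exp_ge_add_one_self[of "- s"] by (intro power_mono) auto
  then show ?thesis
    by (simp flip: exp_of_nat_mult)
qed

text \<open>From \<open>exp x \<ge> 1 + x\<close> the right-hand side is at least
  \<open>x / (1 + x)\<close>, and the denominator is at most 2 for \<open>x \<le> 1\<close>, while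
  the quotient is at least 1/2 beyond. With \<open>x\<close> the expected number of hits of a set,
  this bounds from below the chance of hitting it.\<close>

lemma one_minus_exp_ge:
  assumes "0 \<le> (x::real)"
  shows "min 1 x / 2 \<le> 1 - exp (- x)"
proof -
  have "exp (- x) \<le> 1 / (1 + x)"
    using assms exp_ge_add_one_self[of x] by (simp add: exp_minus field_simps)
  moreover have "min 1 x / 2 \<le> 1 - 1 / (1 + x)"
    using assms mult_left_le[of x x] by (auto simp: min_def field_simps)
  ultimately show ?thesis by linarith
qed

text \<open>A single term of the binomial expansion of \<open>(1 + k / n) ^ n\<close> is at most the
  whole, which is at most \<open>exp k\<close>. The result is the usual
  \<open>(e * n / k) ^ k\<close>, written as one exponential.\<close>

lemma choose_le_exp:
  assumes "1 \<le> k" "1 \<le> n"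
  shows "real (n choose k) \<le> exp (real k * (1 + ln (real n / real k)))"
proof -
  define x where "x = real k / real n"
  have x: "x > 0" using assms by (simp add: x_def)
  have "real (n choose k) * x ^ k \<le> (\<Sum>i\<le>n. real (n choose i) * x ^ i)"
  proof (cases "k \<le> n")
    case True
    then show ?thesis using x by (intro member_le_sum) auto
  next
    case False
    then have "n choose k = 0" by (simp add: binomial_eq_0)
    moreover have "0 \<le> (\<Sum>i\<le>n. real (n choose i) * x ^ i)"
      using x by (intro sum_nonneg) auto
    ultimately show ?thesis by (simp only: of_nat_0 mult_zero_left)
  qed
  also have "\<dots> = (x + 1) ^ n" by (simp add: binomial_ring)
  also have "\<dots> \<le> exp x ^ n"
    using x by (intro power_mono) (auto simp: add.commute exp_ge_add_one_self)
  also have "\<dots> = exp (real k)"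
    using assms by (simp add: x_def flip: exp_of_nat_mult)
  finally have "real (n choose k) \<le> exp (real k) / x ^ k"
    using x by (simp add: field_simps)
  also have "\<dots> = exp (real k) * (real n / real k) ^ k"
    by (simp add: x_def power_divide)
  also have "(real n / real k) ^ k = exp (ln (real n / real k)) ^ k"
    using assms by simp
  also have "exp (real k) * exp (ln (real n / real k)) ^ k = exp (real k * (1 + ln (real n / real k)))"
    by (simp only: exp_of_nat_mult[symmetric] exp_add[symmetric]) (simp add: algebra_simps)
  finally show ?thesis .
qed

section \<open>Cells of a partition and conflicts inside them\<close>

lemma prob_fiber_sum:
  assumes "finite S"
  shows "measure_pmf.prob D {x. P x \<and> \<kappa> x \<in> S} = (\<Sum>z\<in>S. measure_pmf.prob D {x. P x \<and> \<kappa> x = z})"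
proof -
  have "{x. P x \<and> \<kappa> x \<in> S} = (\<Union>z\<in>S. {x. P x \<and> \<kappa> x = z})" by auto
  then show ?thesis
    using assms by (simp add: measure_pmf.finite_measure_finite_Union disjoint_family_on_def disjoint_iff)
qed

text \<open>The cells are the fibers of \<open>\<kappa>\<close>. The condition says that the sample
  does not refute that \<open>f\<close> factors through \<open>\<kappa>\<close>.\<close>

definition consistent :: "('a \<Rightarrow> 'b) \<Rightarrow> ('a \<Rightarrow> bool) \<Rightarrow> 'a list \<Rightarrow> bool" where
  "consistent \<kappa> f xs \<longleftrightarrow> (\<forall>x\<in>set xs. \<forall>y\<in>set xs. \<kappa> x = \<kappa> y \<longrightarrow> f x = f y)"

lemma consistent_append: "consistent \<kappa> f (xs @ ys) \<Longrightarrow> consistent \<kappa> f xs \<and> consistent \<kappa> f ys"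
  by (auto simp: consistent_def)

text \<open>
  Avoiding several cells at once is at most as likely as if the cells were avoided independently.
  Expanding the product over subsets of \<open>Z\<close> turns the expectation into a combination of such
  avoidance probabilities with nonnegative coefficients.
\<close>
lemma expectation_occupied_prod_le:
  fixes t :: "'b \<Rightarrow> real" and \<kappa> :: "'a \<Rightarrow> 'b" and P :: "'a \<Rightarrow> bool"
  assumes "finite Z" and t: "\<And>z. z \<in> Z \<Longrightarrow> 0 \<le> t z \<and> t z \<le> 1"
  defines "B \<equiv> \<lambda>xs. \<kappa> ` {x \<in> set xs. P x}"
  shows "(\<integral>xs. (\<Prod>z\<in>Z. if z \<in> B xs then t z else 1) \<partial>measure_pmf (replicate_pmf m D)) \<le>
    (\<Prod>z\<in>Z. (1 - t z) * exp (- real m * measure_pmf.prob D {x. P x \<and> \<kappa> x = z}) + t z)"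
proof -
  let ?p = "\<lambda>z. measure_pmf.prob D {x. P x \<and> \<kappa> x = z}"
  let ?c = "\<lambda>S. (\<Prod>z\<in>S. 1 - t z) * (\<Prod>z\<in>Z-S. t z)"
  have expand: "(\<Prod>z\<in>Z. if z \<in> B xs then t z else 1) =
      (\<Sum>S\<in>Pow Z. ?c S * indicator {xs. set xs \<subseteq> - {x. P x \<and> \<kappa> x \<in> S}} xs)" for xs
  proof -
    \<comment> \<open>Each factor is written as \<open>1 - t z\<close> times the indicator that
      \<open>z\<close> is empty, plus \<open>t z\<close>, so that \<open>prod_add\<close>
      applies.\<close>
    have "(\<Prod>z\<in>Z. if z \<in> B xs then t z else 1) = (\<Prod>z\<in>Z. (1 - t z) * (if z \<in> B xs then 0 else 1) + t z)"
      by (intro prod.cong) auto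
    also have "\<dots> = (\<Sum>S\<in>Pow Z. (\<Prod>z\<in>S. (1 - t z) * (if z \<in> B xs then 0 else 1)) * (\<Prod>z\<in>Z-S. t z))"
      by (rule prod_add) fact
    also have "\<dots> = (\<Sum>S\<in>Pow Z. ?c S * indicator {xs. set xs \<subseteq> - {x. P x \<and> \<kappa> x \<in> S}} xs)"
    proof (intro sum.cong refl)
      fix S assume "S \<in> Pow Z"
      then have fin: "finite S" using \<open>finite Z\<close> finite_subset by blast
      have "(\<Prod>z\<in>S. if z \<in> B xs then 0 else 1 :: real) = indicator {xs. set xs \<subseteq> - {x. P x \<and> \<kappa> x \<in> S}} xs"
      proof (cases "set xs \<subseteq> - {x. P x \<and> \<kappa> x \<in> S}")
        case True
        then have "\<forall>z\<in>S. z \<notin> B xs" by (auto simp: B_def)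
        then show ?thesis using True by simp
      next
        case False
        then have "\<exists>z\<in>S. z \<in> B xs" by (auto simp: B_def)
        then have "(\<Prod>z\<in>S. if z \<in> B xs then 0 else 1 :: real) = 0"
          using fin by (intro prod_zero) auto
        then show ?thesis using False by simp
      qed
      then show "(\<Prod>z\<in>S. (1 - t z) * (if z \<in> B xs then 0 else 1)) * (\<Prod>z\<in>Z-S. t z) =
          ?c S * indicator {xs. set xs \<subseteq> - {x. P x \<and> \<kappa> x \<in> S}} xs"
        by (simp add: prod.distrib)
    qed
    finally show ?thesis .
  qed
  have avoid: "measure_pmf.prob (replicate_pmf m D) {xs. set xs \<subseteq> - {x. P x \<and> \<kappa> x \<in> S}} \<le>
      (\<Prod>z\<in>S. exp (- real m * ?p z))" if "S \<subseteq> Z" for S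
  proof -
    have fin: "finite S" using that \<open>finite Z\<close> finite_subset by blast
    have "measure_pmf.prob D (- {x. P x \<and> \<kappa> x \<in> S}) = 1 - (\<Sum>z\<in>S. ?p z)"
      using measure_pmf.prob_compl[of "{x. P x \<and> \<kappa> x \<in> S}" D]
      by (simp add: Compl_eq_Diff_UNIV prob_fiber_sum[OF fin])
    moreover have "(\<Sum>z\<in>S. ?p z) \<le> 1"
      using prob_fiber_sum[OF fin, of D P \<kappa>] by (metis measure_pmf.prob_le_1)
    moreover have "(\<Sum>z\<in>S. ?p z) \<ge> 0" by (simp add: sum_nonneg)
    ultimately have "measure_pmf.prob (replicate_pmf m D) {xs. set xs \<subseteq> - {x. P x \<and> \<kappa> x \<in> S}} \<le>
        exp (- real m * (\<Sum>z\<in>S. ?p z))"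
      by (simp only: prob_replicate_pmf_all one_minus_power_le_exp)
    then show ?thesis by (simp add: sum_distrib_left exp_sum[OF fin] flip: sum_negf)
  qed
  have "(\<integral>xs. (\<Prod>z\<in>Z. if z \<in> B xs then t z else 1) \<partial>measure_pmf (replicate_pmf m D)) =
      (\<Sum>S\<in>Pow Z. ?c S * measure_pmf.prob (replicate_pmf m D) {xs. set xs \<subseteq> - {x. P x \<and> \<kappa> x \<in> S}})"
    unfolding expand
    by (subst Bochner_Integration.integral_sum)
       (auto intro!: integrable_mult_right integrable_measure_pmf_unit_bound)
  also have "\<dots> \<le> (\<Sum>S\<in>Pow Z. ?c S * (\<Prod>z\<in>S. exp (- real m * ?p z)))"
    using t by (intro sum_mono mult_left_mono avoid mult_nonneg_nonneg prod_nonneg) auto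
  \<comment> \<open>The same expansion, read backwards.\<close>
  also have "\<dots> = (\<Prod>z\<in>Z. (1 - t z) * exp (- real m * ?p z) + t z)"
    by (subst prod_add[OF \<open>finite Z\<close>]) (simp add: prod.distrib mult_ac)
  finally show ?thesis .
qed

text \<open>Either a single term already reaches the truncation value 1, or nothing is truncated and
  Cauchy-Schwarz over at most \<open>N\<close> terms applies. The squares arise because a conflict
  in a cell needs two hits.\<close>

lemma sum_min_one_square_ge_one:
  fixes b :: "'b \<Rightarrow> real"
  assumes "finite Z" "card Z \<le> N" "\<And>z. z \<in> Z \<Longrightarrow> 0 \<le> b z" "sqrt (real N) \<le> (\<Sum>z\<in>Z. b z)" "N > 0"
  shows "1 \<le> (\<Sum>z\<in>Z. (min 1 (b z))\<^sup>2)"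
proof (cases "\<exists>z\<in>Z. b z \<ge> 1")
  case True
  then obtain z where "z \<in> Z" "b z \<ge> 1" by blast
  then show ?thesis
    using member_le_sum[of z Z "\<lambda>z. (min 1 (b z))\<^sup>2"] assms(1) by simp
next
  case False
  then have eq: "(\<Sum>z\<in>Z. (min 1 (b z))\<^sup>2) = (\<Sum>z\<in>Z. (b z)\<^sup>2)"
    by (intro sum.cong) (auto simp: min_def not_le)
  have "real N \<le> (\<Sum>z\<in>Z. b z)\<^sup>2"
    using assms(4) by (simp add: real_le_lsqrt sqrt_le_D)
  also have "\<dots> \<le> (\<Sum>z\<in>Z. (b z)\<^sup>2) * card Z"
    by (rule sum_squared_le_sum_of_squares)
  also have "\<dots> \<le> (\<Sum>z\<in>Z. (b z)\<^sup>2) * N"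
    using assms(2) by (intro mult_left_mono) (auto simp: sum_nonneg)
  finally show ?thesis using assms(5) by (simp add: eq)
qed

text \<open>Only conflicts between a 0-label in the first half and a 1-label in the second are
  exploited, so that the two halves can be treated independently.\<close>

lemma prob_consistent_batch_le:
  assumes "finite Z" "card Z \<le> N" "N > 0"
    and far: "\<epsilon> \<le> (\<Sum>z\<in>Z. min (measure_pmf.prob D {x. \<not> f x \<and> \<kappa> x = z}) (measure_pmf.prob D {x. f x \<and> \<kappa> x = z}))"
    and m: "sqrt (real N) \<le> real m * \<epsilon>"
  shows "measure_pmf.prob (replicate_pmf (m + m) D) {xs. consistent \<kappa> f xs} \<le> exp (- 1 / 4)"
proof -
  let ?p = "\<lambda>z. measure_pmf.prob D {x. \<not> f x \<and> \<kappa> x = z}"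
  let ?q = "\<lambda>z. measure_pmf.prob D {x. f x \<and> \<kappa> x = z}"
  let ?t = "\<lambda>z. exp (- real m * ?q z)"
  let ?s = "\<lambda>z. exp (- real m * ?p z)"
  let ?b = "\<lambda>z. real m * min (?p z) (?q z)"
  define B where "B = (\<lambda>xs. \<kappa> ` {x \<in> set xs. \<not> f x})"
  have second_half: "measure_pmf.prob (replicate_pmf m D) {ys. consistent \<kappa> f (xs @ ys)} \<le>
      (\<Prod>z\<in>Z. if z \<in> B xs then ?t z else 1)" for xs
  proof -
    let ?S = "Z \<inter> B xs"
    have fin: "finite ?S" using assms(1) by simp
    \<comment> \<open>Given \<open>xs\<close>, the second half must avoid the 1-labelled points of
      every cell where \<open>xs\<close> has a 0-label.\<close>
    have "measure_pmf.prob (replicate_pmf m D) {ys. consistent \<kappa> f (xs @ ys)} \<le>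
        measure_pmf.prob (replicate_pmf m D) {ys. set ys \<subseteq> - {x. f x \<and> \<kappa> x \<in> ?S}}"
      by (intro measure_pmf.finite_measure_mono) (auto simp: consistent_def B_def)
    also have "\<dots> = (1 - (\<Sum>z\<in>?S. ?q z)) ^ m"
      using measure_pmf.prob_compl[of "{x. f x \<and> \<kappa> x \<in> ?S}" D]
      by (simp only: prob_replicate_pmf_all) (simp add: Compl_eq_Diff_UNIV prob_fiber_sum[OF fin, symmetric])
    also have "\<dots> \<le> exp (- real m * (\<Sum>z\<in>?S. ?q z))"
      by (intro one_minus_power_le_exp)
         (simp_all add: sum_nonneg prob_fiber_sum[OF fin, symmetric])
    also have "\<dots> = (\<Prod>z\<in>?S. ?t z)"
      by (simp add: sum_distrib_left exp_sum[OF fin] flip: sum_negf)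
    also have "\<dots> = (\<Prod>z\<in>Z. if z \<in> B xs then ?t z else 1)"
      by (rule prod.inter_restrict[OF assms(1)])
    finally show ?thesis .
  qed
  have "measure_pmf.prob (replicate_pmf (m + m) D) {xs. consistent \<kappa> f xs} \<le>
      (\<integral>xs. (\<Prod>z\<in>Z. if z \<in> B xs then ?t z else 1) \<partial>measure_pmf (replicate_pmf m D))"
    unfolding prob_replicate_pmf_add
    by (intro integral_mono integrable_measure_pmf_unit_bound second_half prod_nonneg prod_le_1) auto
  also have "\<dots> \<le> (\<Prod>z\<in>Z. (1 - ?t z) * ?s z + ?t z)"
    unfolding B_def by (rule expectation_occupied_prod_le) (use assms(1) in auto)
  \<comment> \<open>Each factor is 1 minus the product of two hitting probabilities, and both of
    these are at least \<open>min 1 (?b z) / 2\<close>.\<close>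
  also have "\<dots> \<le> (\<Prod>z\<in>Z. exp (- ((min 1 (?b z))\<^sup>2 / 4)))"
  proof (intro prod_mono conjI)
    fix z
    have mono: "exp (- real m * r) \<le> exp (- ?b z)" if "min (?p z) (?q z) \<le> r" for r
      using that by (simp add: mult_left_mono)
    have "min 1 (?b z) / 2 \<le> 1 - exp (- ?b z)"
      by (rule one_minus_exp_ge) simp
    then have "min 1 (?b z) / 2 \<le> 1 - ?s z" "min 1 (?b z) / 2 \<le> 1 - ?t z"
      using mono[OF min.cobounded1] mono[OF min.cobounded2] by linarith+
    then have "(min 1 (?b z) / 2) * (min 1 (?b z) / 2) \<le> (1 - ?s z) * (1 - ?t z)"
      by (intro mult_mono) auto
    moreover have "(1 - ?t z) * ?s z + ?t z = 1 - (1 - ?s z) * (1 - ?t z)"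
      by (simp add: algebra_simps)
    moreover have "1 - (min 1 (?b z))\<^sup>2 / 4 \<le> exp (- ((min 1 (?b z))\<^sup>2 / 4))"
      using exp_ge_add_one_self[of "- ((min 1 (?b z))\<^sup>2 / 4)"] by simp
    ultimately show "(1 - ?t z) * ?s z + ?t z \<le> exp (- ((min 1 (?b z))\<^sup>2 / 4))"
      by (simp add: power2_eq_square)
    show "0 \<le> (1 - ?t z) * ?s z + ?t z"
      by (intro add_nonneg_nonneg mult_nonneg_nonneg) auto
  qed
  also have "\<dots> = exp (- ((\<Sum>z\<in>Z. (min 1 (?b z))\<^sup>2) / 4))"
    using assms(1) by (simp add: exp_sum[symmetric] sum_negf sum_divide_distrib)
  also have "1 \<le> (\<Sum>z\<in>Z. (min 1 (?b z))\<^sup>2)"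
  proof (rule sum_min_one_square_ge_one[OF assms(1,2) _ _ assms(3)])
    have "real m * \<epsilon> \<le> real m * (\<Sum>z\<in>Z. min (?p z) (?q z))"
      using far by (intro mult_left_mono) auto
    then show "sqrt (real N) \<le> (\<Sum>z\<in>Z. ?b z)"
      using m by (simp add: sum_distrib_left)
  qed auto
  then have "exp (- ((\<Sum>z\<in>Z. (min 1 (?b z))\<^sup>2) / 4)) \<le> exp (- 1 / 4)"
    by simp
  finally show ?thesis by simp
qed

text \<open>A consistent sample is consistent on each of its \<open>L\<close> independent
  batches.\<close>

lemma prob_consistent_batches_le:
  assumes "measure_pmf.prob (replicate_pmf b D) {xs. consistent \<kappa> f xs} \<le> c"
  shows "measure_pmf.prob (replicate_pmf (L * b) D) {xs. consistent \<kappa> f xs} \<le> c ^ L"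
proof (induction L)
  case 0
  then show ?case by simp
next
  case (Suc L)
  let ?I = "\<lambda>xs. indicator {xs. consistent \<kappa> f xs} xs :: real"
  have c: "0 \<le> c" using assms order_trans[OF measure_nonneg] by blast
  have "measure_pmf.prob (replicate_pmf (Suc L * b) D) {xs. consistent \<kappa> f xs} =
     (\<integral>xs. measure_pmf.prob (replicate_pmf (L * b) D) {ys. consistent \<kappa> f (xs @ ys)} \<partial>measure_pmf (replicate_pmf b D))"
    by (simp add: prob_replicate_pmf_add)
  also have "\<dots> \<le> (\<integral>xs. c ^ L * ?I xs \<partial>measure_pmf (replicate_pmf b D))"
  proof (rule integral_mono)
    fix xs
    have "measure_pmf.prob (replicate_pmf (L * b) D) {ys. consistent \<kappa> f (xs @ ys)} \<le>
        measure_pmf.prob (replicate_pmf (L * b) D) {ys. consistent \<kappa> f ys}"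
      by (intro measure_pmf.finite_measure_mono) (auto dest: consistent_append)
    moreover have "{ys. consistent \<kappa> f (xs @ ys)} = {}" if "\<not> consistent \<kappa> f xs"
      using that by (auto dest: consistent_append)
    ultimately show "measure_pmf.prob (replicate_pmf (L * b) D) {ys. consistent \<kappa> f (xs @ ys)} \<le> c ^ L * ?I xs"
      using Suc by (cases "consistent \<kappa> f xs") auto
  qed (auto intro!: integrable_mult_right integrable_measure_pmf_unit_bound)
  also have "\<dots> = c ^ L * measure_pmf.prob (replicate_pmf b D) {xs. consistent \<kappa> f xs}"
    by simp
  also have "\<dots> \<le> c ^ L * c"
    using assms c by (intro mult_left_mono) auto
  finally show ?case by (simp add: mult.commute)
qed

section \<open>Juntas as functions of the cells\<close>

text \<open>Encoding a cell by its set of true coordinates makes \<open>Pow J\<close> the index set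
  of the cells.\<close>

definition restrict_to :: "nat set \<Rightarrow> bool list \<Rightarrow> nat set" where
  "restrict_to J x = {i \<in> J. x ! i}"

lemma restrict_to_eq_iff: "restrict_to J x = restrict_to J y \<longleftrightarrow> (\<forall>i\<in>J. x ! i = y ! i)"
  by (auto simp: restrict_to_def)

text \<open>Padding the relevant coordinates to exactly \<open>k\<close> lets the union bound run
  over \<open>n choose k\<close> sets.\<close>

lemma juntas_superset_coords:
  assumes "f \<in> juntas n k" "k \<le> n"
  obtains J where "J \<subseteq> {..<n}" "card J = k"
    "\<And>x y. x \<in> cube n \<Longrightarrow> y \<in> cube n \<Longrightarrow> restrict_to J x = restrict_to J y \<Longrightarrow> f x = f y"
proof -
  obtain J where J: "J \<subseteq> {..<n}" "card J \<le> k"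
    "\<And>x y. x \<in> cube n \<Longrightarrow> y \<in> cube n \<Longrightarrow> \<forall>i\<in>J. x ! i = y ! i \<Longrightarrow> f x = f y"
    using assms(1) unfolding juntas_def by blast
  obtain J' where "J \<subseteq> J'" "J' \<subseteq> {..<n}" "card J' = k"
    using exists_subset_between[of J k "{..<n}"] J assms(2) by auto
  then show ?thesis
    using that[of J'] J(3) unfolding restrict_to_eq_iff by (meson subsetD)
qed

lemma junta_of_restrict_to:
  assumes "J \<subseteq> {..<n}" "card J \<le> k"
  shows "(\<lambda>x. g (restrict_to J x)) \<in> juntas n k"
  using assms unfolding juntas_def by (auto simp: restrict_to_eq_iff[symmetric] intro!: exI[of _ J])

lemma dist_class_le:
  assumes "h \<in> H"
  shows "dist_class D f H \<le> measure_pmf.prob D {x. f x \<noteq> h x}"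
  unfolding dist_class_def using assms
  by (intro cINF_lower) (auto intro: bdd_belowI[of _ 0])

text \<open>The right-hand side is the distance to the junta taking the majority vote on each cell.\<close>
lemma dist_juntas_le_sum_min:
  assumes "J \<subseteq> {..<n}" "card J \<le> k"
  shows "dist_class D f (juntas n k) \<le>
    (\<Sum>z\<in>Pow J. min (measure_pmf.prob D {x. \<not> f x \<and> restrict_to J x = z})
       (measure_pmf.prob D {x. f x \<and> restrict_to J x = z}))"
proof -
  let ?p = "\<lambda>z. measure_pmf.prob D {x. \<not> f x \<and> restrict_to J x = z}"
  let ?q = "\<lambda>z. measure_pmf.prob D {x. f x \<and> restrict_to J x = z}"
  let ?h = "\<lambda>x. ?p (restrict_to J x) < ?q (restrict_to J x)"
  have fin: "finite (Pow J)" using assms(1) finite_subset by blast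
  have "dist_class D f (juntas n k) \<le> measure_pmf.prob D {x. f x \<noteq> ?h x}"
    by (intro dist_class_le junta_of_restrict_to[OF assms, of "\<lambda>z. ?p z < ?q z"])
  also have "{x. f x \<noteq> ?h x} = {x. f x \<noteq> ?h x \<and> restrict_to J x \<in> Pow J}"
    by (auto simp: restrict_to_def)
  also have "measure_pmf.prob D \<dots> = (\<Sum>z\<in>Pow J. measure_pmf.prob D {x. f x \<noteq> ?h x \<and> restrict_to J x = z})"
    by (rule prob_fiber_sum[OF fin])
  also have "\<dots> = (\<Sum>z\<in>Pow J. min (?p z) (?q z))"
  proof (intro sum.cong refl)
    fix z
    have "{x. f x \<noteq> ?h x \<and> restrict_to J x = z} =
        (if ?p z < ?q z then {x. \<not> f x \<and> restrict_to J x = z} else {x. f x \<and> restrict_to J x = z})"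
      by auto
    then show "measure_pmf.prob D {x. f x \<noteq> ?h x \<and> restrict_to J x = z} = min (?p z) (?q z)"
      by (simp add: min_def)
  qed
  finally show ?thesis .
qed

section \<open>The tester and its error\<close>

definition junta_consistency_tester :: "nat \<Rightarrow> nat \<Rightarrow> (bool list \<times> bool) list \<Rightarrow> bool pmf" where
  "junta_consistency_tester n k s = return_pmf (\<exists>h\<in>juntas n k. \<forall>(x, b)\<in>set s. h x = b)"

lemma run_junta_consistency_tester:
  "run_tester (junta_consistency_tester n k) m D f =
     map_pmf (\<lambda>xs. \<exists>h\<in>juntas n k. \<forall>x\<in>set xs. h x = f x) (replicate_pmf m D)"
  by (simp add: run_tester_def junta_consistency_tester_def map_pmf_def)

lemma tester_accepts_junta:
  assumes "f \<in> juntas n k"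
  shows "pmf (run_tester (junta_consistency_tester n k) m D f) True = 1"
proof -
  have "\<exists>h\<in>juntas n k. \<forall>x\<in>set xs. h x = f x" for xs
    using assms by blast
  then show ?thesis
    by (simp add: run_junta_consistency_tester)
qed

text \<open>Union bound over the coordinate sets \<open>J\<close>: acceptance forces the sample to
  be consistent with the cells of some \<open>J\<close>, and each \<open>J\<close> survives all
  \<open>L\<close> batches with probability at most \<open>exp (- 1 / 4) ^ L\<close>.\<close>

lemma tester_accept_prob_le:
  assumes "k \<le> n" "set_pmf D \<subseteq> cube n" "\<epsilon> \<le> dist_class D f (juntas n k)"
    and m: "sqrt (2 ^ k) \<le> real m * \<epsilon>"
  shows "pmf (run_tester (junta_consistency_tester n k) (L * (m + m)) D f) True \<le>
    real (n choose k) * exp (- real L / 4)"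
proof -
  let ?R = "replicate_pmf (L * (m + m)) D"
  let ?F = "{J. J \<subseteq> {..<n} \<and> card J = k}"
  have fin: "finite ?F" by simp
  have "pmf (run_tester (junta_consistency_tester n k) (L * (m + m)) D f) True =
      measure_pmf.prob ?R {xs. \<exists>h\<in>juntas n k. \<forall>x\<in>set xs. h x = f x}"
    by (simp add: run_junta_consistency_tester pmf_map vimage_def)
  also have "\<dots> \<le> measure_pmf.prob ?R (\<Union>J\<in>?F. {xs. consistent (restrict_to J) f xs})"
  \<comment> \<open>The inclusion holds only almost surely, since a junta is constrained only on
    \<open>cube n\<close>, where the samples lie.\<close>
  proof (intro measure_pmf.finite_measure_mono_AE)
    show "AE xs in measure_pmf ?R. xs \<in> {xs. \<exists>h\<in>juntas n k. \<forall>x\<in>set xs. h x = f x} \<longrightarrow>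
        xs \<in> (\<Union>J\<in>?F. {xs. consistent (restrict_to J) f xs})"
    proof (intro AE_pmfI impI)
      fix xs assume xs: "xs \<in> set_pmf ?R" "xs \<in> {xs. \<exists>h\<in>juntas n k. \<forall>x\<in>set xs. h x = f x}"
      then obtain h where h: "h \<in> juntas n k" "\<forall>x\<in>set xs. h x = f x" by blast
      have cube: "set xs \<subseteq> cube n" using xs(1) assms(2) by (auto simp: set_replicate_pmf)
      obtain J where "J \<subseteq> {..<n}" "card J = k"
        "\<And>x y. x \<in> cube n \<Longrightarrow> y \<in> cube n \<Longrightarrow> restrict_to J x = restrict_to J y \<Longrightarrow> h x = h y"
        using juntas_superset_coords[OF h(1) assms(1)] by blast
      then show "xs \<in> (\<Union>J\<in>?F. {xs. consistent (restrict_to J) f xs})"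
        using h(2) cube unfolding consistent_def by (auto intro!: exI[of _ J]) (metis subsetD)+
    qed
  qed simp
  also have "\<dots> \<le> (\<Sum>J\<in>?F. measure_pmf.prob ?R {xs. consistent (restrict_to J) f xs})"
    by (rule measure_pmf.finite_measure_subadditive_finite) (use fin in auto)
  also have "\<dots> \<le> (\<Sum>J\<in>?F. exp (- 1 / 4) ^ L)"
  proof (intro sum_mono prob_consistent_batches_le prob_consistent_batch_le)
    fix J assume "J \<in> ?F"
    then have J: "J \<subseteq> {..<n}" "card J = k" by auto
    have "finite J" using J(1) finite_subset by blast
    then show "finite (Pow J)" "card (Pow J) \<le> 2 ^ k" using J(2) by (auto simp: card_Pow)
    show "\<epsilon> \<le> (\<Sum>z\<in>Pow J. min (measure_pmf.prob D {x. \<not> f x \<and> restrict_to J x = z})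
       (measure_pmf.prob D {x. f x \<and> restrict_to J x = z}))"
      using assms(3) dist_juntas_le_sum_min[of J n k D f] J by simp
  qed (use m in auto)
  also have "\<dots> = real (n choose k) * exp (- real L / 4)"
    by (simp add: n_subsets flip: exp_of_nat_mult)
  finally show ?thesis .
qed

lemma dist_class_juntas_le_one: "dist_class D f (juntas n k) \<le> 1"
proof -
  have "(\<lambda>x. True) \<in> juntas n k"
    using junta_of_restrict_to[of "{}" n k "\<lambda>_. True"] by simp
  then show ?thesis
    using dist_class_le[of _ "juntas n k" D f] order_trans[OF _ measure_pmf.prob_le_1] by blast
qed

lemma juntas_eq_UNIV:
  assumes "n \<le> k"
  shows "f \<in> juntas n k"
proof -
  have "x = y" if "x \<in> cube n" "y \<in> cube n" "\<forall>i\<in>{..<n}. x ! i = y ! i" for x y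
    using that by (auto simp: cube_def intro: nth_equalityI)
  then show ?thesis
    using assms by (auto simp: juntas_def intro!: exI[of _ "{..<n}"])
qed

lemma dist_class_member: "f \<in> H \<Longrightarrow> dist_class D f H \<le> 0"
  using dist_class_le[of f H D f] by simp

theorem theorem7p7:
  "\<exists>C::real. C > 0 \<and>
     (\<forall>(n::nat) (k::nat) (\<epsilon>::real). n \<ge> 1 \<longrightarrow> k \<ge> 1 \<longrightarrow> \<epsilon> > 0 \<longrightarrow>
        (\<exists>(m::nat) (T :: (bool list \<times> bool) list \<Rightarrow> bool pmf).
           real m \<le> C * (real k * 2 powr (real k / 2) * log_factor n k / \<epsilon>) \<and>
           df_sample_tester (cube n) (juntas n k) \<epsilon> m T \<and>
           one_sided_error (cube n) (juntas n k) m T))"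
\<comment> \<open>The constant is 17 * 4: \<open>L\<close> is at most \<open>17 * u\<close>, and a
  batch \<open>m + m\<close> is at most \<open>4 * (a / \<epsilon>)\<close>.\<close>
proof (intro exI[of _ "68::real"] conjI allI impI)
  fix n k :: nat and \<epsilon> :: real
  assume n: "n \<ge> 1" and k: "k \<ge> 1" and \<epsilon>: "\<epsilon> > 0"
  let ?T = "junta_consistency_tester n k"
  let ?bound = "\<lambda>M. real M \<le> 68 * (real k * 2 powr (real k / 2) * log_factor n k / \<epsilon>)"
  define lf where "lf = log_factor n k"
  have lf: "lf \<ge> 1" by (simp add: lf_def log_factor_def)
  have "\<exists>M. ?bound M \<and> (\<forall>D f. set_pmf D \<subseteq> cube n \<longrightarrow> \<epsilon> \<le> dist_class D f (juntas n k) \<longrightarrow>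
      pmf (run_tester ?T M D f) True \<le> 1 / 3)"
  \<comment> \<open>In the first case no function is \<open>\<epsilon>\<close>-far from juntas, so
    zero samples suffice.\<close>
  proof (cases "\<epsilon> > 1 \<or> n \<le> k")
    case True
    then have "\<not> \<epsilon> \<le> dist_class D f (juntas n k)" for D f
      using dist_class_juntas_le_one[of D f n k] dist_class_member[OF juntas_eq_UNIV, of n k D f] \<epsilon>
      by auto
    then show ?thesis
      using lf \<epsilon> by (intro exI[of _ 0]) (auto simp: lf_def)
  next
    case False
    then have \<epsilon>1: "\<epsilon> \<le> 1" and kn: "k \<le> n" by auto
    define a where "a = (2::real) powr (real k / 2)"
    have a: "a = sqrt (2 ^ k)" "a \<ge> 1"
      by (simp_all add: a_def powr_half_sqrt[symmetric] powr_powr ge_one_powr_ge_zero flip: powr_realpow)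
    define m where "m = nat \<lceil>a / \<epsilon>\<rceil>"
    define u where "u = real k * lf"
    \<comment> \<open>The logarithm of the union bound is at most \<open>2 * u\<close>, so
      \<open>v / 4 = 2 * u + 2\<close> leaves the exponent \<open>- 2\<close>.\<close>
    define v where "v = 8 * u + 8"
    define L where "L = nat \<lceil>v\<rceil>"
    have ae: "1 \<le> a / \<epsilon>" using \<epsilon> \<epsilon>1 a(2) by (simp add: field_simps)
    \<comment> \<open>Rounding up at most doubles a number that is at least 1; this is where
      \<open>\<epsilon> \<le> 1\<close> enters.\<close>
    have m: "a / \<epsilon> \<le> real m" "real m \<le> 2 * (a / \<epsilon>)"
      using ae unfolding m_def by linarith+
    have u: "1 \<le> u" using k lf mult_mono[of 1 "real k" 1 lf] by (simp add: u_def)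
    then have "9 \<le> v" "v + 1 \<le> 17 * u" by (simp_all add: v_def)
    then have L: "v \<le> real L" "real L \<le> 17 * u"
      unfolding L_def by linarith+
    have "real (L * (m + m)) = real L * (2 * real m)" by simp
    also have "\<dots> \<le> (17 * u) * (2 * (2 * (a / \<epsilon>)))"
      using m(2) L(2) u by (intro mult_mono) auto
    finally have bound: "?bound (L * (m + m))"
      by (simp add: u_def lf_def a_def mult_ac)
    have "ln (real n / real k) \<le> lf"
    proof -
      \<comment> \<open>Dividing a nonnegative number by \<open>ln 2 \<le> 1\<close> does not
        decrease it.\<close>
      have "0 \<le> ln (real n / real k)" using kn k by simp
      then have "ln (real n / real k) \<le> log 2 (real n / real k)"
        using ln_le_minus_one[of 2] ln_gt_zero[of 2] unfolding log_def
        by (simp add: le_divide_eq mult_left_le)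
      then show ?thesis by (simp add: lf_def log_factor_def)
    qed
    then have "real k * (1 + ln (real n / real k)) \<le> real k * (2 * lf)"
      using lf by (intro mult_left_mono) auto
    then have exponent: "real k * (1 + ln (real n / real k)) - real L / 4 \<le> - 2"
      using L(1) by (simp add: u_def v_def algebra_simps)
    have "real (n choose k) * exp (- real L / 4) \<le>
        exp (real k * (1 + ln (real n / real k))) * exp (- real L / 4)"
      using choose_le_exp[OF k n] by (intro mult_right_mono) auto
    also have "\<dots> = exp (real k * (1 + ln (real n / real k)) - real L / 4)"
      by (simp flip: exp_add)
    also have "\<dots> \<le> exp (- 2)"
      using exponent by simp
    also have "exp (- 2) \<le> (1 / 3 :: real)"
      using exp_ge_add_one_self[of "2::real"] by (simp add: exp_minus field_simps)
    finally have small: "real (n choose k) * exp (- real L / 4) \<le> 1 / 3" .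
    have "sqrt (2 ^ k) \<le> real m * \<epsilon>"
      using m(1) \<epsilon> a(1) by (simp add: field_simps)
    then show ?thesis
      using bound small tester_accept_prob_le[OF kn]
      by (intro exI[of _ "L * (m + m)"]) (blast intro: order_trans)
  qed
  then obtain M where M: "?bound M"
    "\<And>D f. set_pmf D \<subseteq> cube n \<Longrightarrow> \<epsilon> \<le> dist_class D f (juntas n k) \<Longrightarrow>
      pmf (run_tester ?T M D f) True \<le> 1 / 3"
    by blast
  have "2 / 3 \<le> pmf (run_tester ?T M D f) False"
    if "set_pmf D \<subseteq> cube n" "\<epsilon> \<le> dist_class D f (juntas n k)" for D f
    using M(2)[OF that] pmf_False_conv_True[of "run_tester ?T M D f"] by simp
  then show "\<exists>(m::nat) (T :: (bool list \<times> bool) list \<Rightarrow> bool pmf).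
      real m \<le> 68 * (real k * 2 powr (real k / 2) * log_factor n k / \<epsilon>) \<and>
      df_sample_tester (cube n) (juntas n k) \<epsilon> m T \<and>
      one_sided_error (cube n) (juntas n k) m T"
    using M(1) by (intro exI[of _ M] exI[of _ ?T])
      (auto simp: df_sample_tester_def one_sided_error_def tester_accepts_junta)
qed simp

end
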